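(* Let $\pi^*$ be the policy generated by $f^*$ with initial value $y_0=0$. Then $\pi^*$ is optimal for the power utility dividend problem, i.e. $\widehat J(x)=\widehat J_{\pi^*}(x)$ for all $x\in X$.
   Context: Setting. $X=\mathbb{Z}$, $\beta\in(0,1)$ is a discount factor, $Z_1,Z_2,\ldots$ are i.i.d. integer-valued random variables with $\mathbb{P}(Z_n=k)=q_k$, $k\in\mathbb{Z}$; $Z$ denotes a generic copy. Standing assumptions: $\mathbb{E}Z^+<\infty$ (where $Z^+=\max\{Z,0\}$) and $\mathbb{P}(Z<0)>0$. Action sets: $A(x)=\{0,\ldots,x\}$ for $x\ge0$ and $A(x)=\{0\}$ for $x<0$; $D=\{(x,a):x\in X,a\in A(x)\}$. A policy $\pi=(\pi_k)_{k\ge0}$ is a sequence of maps assigning to each history $(x_0,a_0,\ldots,x_{k-1},a_{k-1},x_k)$ with $(x_m,a_m)\in D$ an action in $A(x_k)$; $\Pi$ is the set of all policies. Under $\pi$ and $x_0=x$, $a_k=\pi_k(x_0,a_0,\ldots,x_k)$, and $x_{k+1}=x_k-a_k+Z_{k+1}$ if $x_k\ge0$, $x_{k+1}=x_k$ if $x_k<0$; expectation is $\mathbb{E}_x^\pi$. The ruin time $\tau$ is the smallest $n\in\mathbb{N}_0$ with $x_n<0$ ($\tau=\infty$ if there is none). Fix $\gamma\in(0,1)$ and $U_\gamma(x)=x^\gamma$. The power utility dividend problem: $\widehat J_\pi(x)=\mathbb{E}_x^\pi U_\gamma\big(\sum_{k=0}^\infty\beta^k a_k\big)$, $\widehat J(x)=\sup_{\pi\in\Pi}\widehat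 J_\pi(x)$. For $x\in X$, $y\ge0$, $J(x,y)=\sup_{\pi\in\Pi}\mathbb{E}_x^\pi\big(\sum_{k=0}^{\tau-1}\beta^k a_k+y\big)^\gamma$, empty sums being $0$; thus $J(x,y)=y^\gamma$ for $x<0$. For $x\in\mathbb{N}_0$, $y\ge0$ let $G(x,y)=\sum_{k=-\infty}^\infty J(x+k,y)q_k$. For $x\ge0$, $f^*(x,y)$ is the largest maximiser over $a\in A(x)$ of $a\mapsto\beta^\gamma G(x-a,\frac{a+y}{\beta})$; for $x<0$, $f^*(x,y)=0$. The policy $\pi^*=(\pi_k^* )_{k\ge0}$ generated by $f^*$ with fixed initial value $y_0\ge0$ is $\pi^*_k(x_0,a_0,\ldots,x_k)=f^*(x_k,y_k)$, where $y_k=\frac{y_{k-1}+f^*(x_{k-1},y_{k-1})}{\beta}$ for $k\ge1$. *)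

theory Defs
  imports "HOL-Probability.Probability" "HOL-Library.Extended_Nat"
begin

definition actions :: "int \<Rightarrow> int set" where
  "actions x = (if x \<ge> 0 then {0..x} else {0})"

definition admissible_pairs :: "(int \<times> int) set" where
  "admissible_pairs = {(x, a). a \<in> actions x}"

text \<open>A history \<open>(x\<^sub>0, a\<^sub>0, \<dots>, x\<^sub>k\<^sub>-\<^sub>1, a\<^sub>k\<^sub>-\<^sub>1, x\<^sub>k)\<close> is split into the
  chronological list of the pairs \<open>(x\<^sub>m, a\<^sub>m)\<close>, \<open>m < k\<close>, and the current state \<open>x\<^sub>k\<close>.
  Values of a policy outside of these histories are unconstrained and never used.\<close>

type_synonym policy = "nat \<Rightarrow> (int \<times> int) list \<Rightarrow> int \<Rightarrow> int"

definition policies :: "policy set" where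
  "policies = {\<pi>. \<forall>k h x. length h = k \<and> set h \<subseteq> admissible_pairs \<longrightarrow> \<pi> k h x \<in> actions x}"

text \<open>The controlled process driven by the noise sequence \<open>z\<close>; \<open>z (Suc k)\<close> enters the
  transition from time \<open>k\<close> to time \<open>Suc k\<close>, so \<open>z 0\<close> is not used.\<close>

primrec history :: "policy \<Rightarrow> int \<Rightarrow> (nat \<Rightarrow> int) \<Rightarrow> nat \<Rightarrow> (int \<times> int) list \<times> int" where
  "history \<pi> x z 0 = ([], x)"
| "history \<pi> x z (Suc k) =
     (let (h, s) = history \<pi> x z k; a = \<pi> k h s
      in (h @ [(s, a)], if s \<ge> 0 then s - a + z (Suc k) else s))"

definition state :: "policy \<Rightarrow> int \<Rightarrow> (nat \<Rightarrow> int) \<Rightarrow> nat \<Rightarrow> int" where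
  "state \<pi> x z k = snd (history \<pi> x z k)"

definition action :: "policy \<Rightarrow> int \<Rightarrow> (nat \<Rightarrow> int) \<Rightarrow> nat \<Rightarrow> int" where
  "action \<pi> x z k = \<pi> k (fst (history \<pi> x z k)) (snd (history \<pi> x z k))"

text \<open>The infimum of the empty set in \<^typ>\<open>enat\<close> is \<open>\<infinity>\<close>.\<close>

definition ruin_time :: "policy \<Rightarrow> int \<Rightarrow> (nat \<Rightarrow> int) \<Rightarrow> enat" where
  "ruin_time \<pi> x z = (INF n \<in> {n. state \<pi> x z n < 0}. enat n)"

text \<open>All rewards are nonnegative. They are valued in \<^typ>\<open>ennreal\<close>, so that series,
  expectations and suprema have their usual meaning, with value \<open>\<infinity>\<close> in case of divergence.\<close>

definition power_utility :: "real \<Rightarrow> ennreal \<Rightarrow> ennreal" where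
  "power_utility \<gamma> x = (if x = \<infinity> then \<infinity> else ennreal (enn2real x powr \<gamma>))"

definition total_dividends :: "real \<Rightarrow> policy \<Rightarrow> int \<Rightarrow> (nat \<Rightarrow> int) \<Rightarrow> ennreal" where
  "total_dividends \<beta> \<pi> x z = (\<Sum>k. ennreal (\<beta> ^ k * real_of_int (action \<pi> x z k)))"

definition dividends_until_ruin :: "real \<Rightarrow> policy \<Rightarrow> int \<Rightarrow> (nat \<Rightarrow> int) \<Rightarrow> ennreal" where
  "dividends_until_ruin \<beta> \<pi> x z =
     (\<Sum>k. if enat k < ruin_time \<pi> x z
           then ennreal (\<beta> ^ k * real_of_int (action \<pi> x z k)) else 0)"

definition J_hat_policy ::
  "'w measure \<Rightarrow> (nat \<Rightarrow> 'w \<Rightarrow> int) \<Rightarrow> real \<Rightarrow> real \<Rightarrow> policy \<Rightarrow> int \<Rightarrow> ennreal" where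
  "J_hat_policy M Z \<beta> \<gamma> \<pi> x =
     (\<integral>\<^sup>+\<omega>. power_utility \<gamma> (total_dividends \<beta> \<pi> x (\<lambda>n. Z n \<omega>)) \<partial>M)"

definition J_hat ::
  "'w measure \<Rightarrow> (nat \<Rightarrow> 'w \<Rightarrow> int) \<Rightarrow> real \<Rightarrow> real \<Rightarrow> int \<Rightarrow> ennreal" where
  "J_hat M Z \<beta> \<gamma> x = (SUP \<pi> \<in> policies. J_hat_policy M Z \<beta> \<gamma> \<pi> x)"

definition J ::
  "'w measure \<Rightarrow> (nat \<Rightarrow> 'w \<Rightarrow> int) \<Rightarrow> real \<Rightarrow> real \<Rightarrow> int \<Rightarrow> real \<Rightarrow> ennreal" where
  "J M Z \<beta> \<gamma> x y =
     (SUP \<pi> \<in> policies.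
        \<integral>\<^sup>+\<omega>. power_utility \<gamma> (dividends_until_ruin \<beta> \<pi> x (\<lambda>n. Z n \<omega>) + ennreal y) \<partial>M)"

definition G ::
  "'w measure \<Rightarrow> (nat \<Rightarrow> 'w \<Rightarrow> int) \<Rightarrow> (int \<Rightarrow> real) \<Rightarrow> real \<Rightarrow> real \<Rightarrow> int \<Rightarrow> real \<Rightarrow> ennreal" where
  "G M Z q \<beta> \<gamma> x y = (\<Sum>\<^sub>\<infinity>k\<in>UNIV. J M Z \<beta> \<gamma> (x + k) y * ennreal (q k))"

definition f_star ::
  "'w measure \<Rightarrow> (nat \<Rightarrow> 'w \<Rightarrow> int) \<Rightarrow> (int \<Rightarrow> real) \<Rightarrow> real \<Rightarrow> real \<Rightarrow> int \<Rightarrow> real \<Rightarrow> int" where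
  "f_star M Z q \<beta> \<gamma> x y =
     (let v = (\<lambda>a. ennreal (\<beta> powr \<gamma>) * G M Z q \<beta> \<gamma> (x - a) ((real_of_int a + y) / \<beta>))
      in if x \<ge> 0 then Max {a \<in> actions x. \<forall>b \<in> actions x. v b \<le> v a} else 0)"

text \<open>The number \<open>y\<^sub>k\<close> reached from \<open>y\<^sub>0\<close> along a history; only its states matter.\<close>

definition wealth :: "real \<Rightarrow> (int \<Rightarrow> real \<Rightarrow> int) \<Rightarrow> real \<Rightarrow> (int \<times> int) list \<Rightarrow> real" where
  "wealth \<beta> f y0 h = foldl (\<lambda>y (x, _). (y + real_of_int (f x y)) / \<beta>) y0 h"

definition generated_policy :: "real \<Rightarrow> (int \<Rightarrow> real \<Rightarrow> int) \<Rightarrow> real \<Rightarrow> policy" where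
  "generated_policy \<beta> f y0 = (\<lambda>k h x. f x (wealth \<beta> f y0 h))"

end

theory Submission
  imports Defs
begin

text \<open>
  The optimal value \<open>J x y\<close> depends on the state \<open>x\<close> and on the wealth \<open>y\<close> collected so far, measured in
  current units: after a dividend \<open>a\<close> one has \<open>\<beta> * D + a + y = \<beta> * (D + (a + y) / \<beta>)\<close>, and the power
  utility turns the factor \<open>\<beta>\<close> into \<open>\<beta> powr \<gamma>\<close>.  Conditioning on the first noise variable therefore
  expresses the value of a policy at \<open>(x, y)\<close> through the values of the policy that remains after the
  first period, and bounding the latter by \<open>J\<close> gives one half of the Bellman equation,

  \<open>J x y \<le> max\<^sub>a \<beta> powr \<gamma> * (\<Sum>k. q k * J (x - a + k) ((a + y) / \<beta>))\<close> for \<open>x \<ge> 0\<close>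

  (lemmas \<open>policy_value_step\<close> and \<open>policy_value_le_bellman\<close>).  Only upper bounds of \<open>J\<close> are at stake,
  since \<open>J\<close> dominates the value of the generated policy by definition.  As the action set is finite,
  \<open>f\<^sup>*\<close> attains the maximum.  The policy generated by \<open>f\<^sup>*\<close> from \<open>y\<close>, stripped of its first period, is generated
  by \<open>f\<^sup>*\<close> from \<open>(y + f\<^sup>* x y) / \<beta>\<close>, so the inequality can be iterated along this policy: \<open>J x y\<close>
  is at most its expected utility from \<open>n\<close> periods plus a remainder.

  Subadditivity of the power function separates \<open>y\<close> from the future dividends,
  \<open>J x y \<le> y powr \<gamma> + K + x\<^sup>+\<close> for a constant \<open>K\<close>, because the total dividends have expectation at most
  \<open>x\<^sup>+ + \<beta> * E Z\<^sup>+ / (1 - \<beta>)\<close>.  The part \<open>y powr \<gamma>\<close> is absorbed by the \<open>n\<close>-period utility, and what is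
  left of the remainder is at most \<open>(\<beta> powr \<gamma>) ^ n * (K + x\<^sup>+ + n * E Z\<^sup>+)\<close>
  (lemma \<open>optimal_value_le_truncated\<close>), which tends to \<open>0\<close>.  Since utilities of truncated sums
  are bounded by those of the full sums, \<open>J x y\<close> is at most the value of the generated policy.
  Finally \<open>J x 0\<close> is the optimal value of the dividend problem, as nothing can be paid after ruin.
\<close>

section \<open>Power utility\<close>

text \<open>For a share \<open>t / s \<le> 1\<close> one has \<open>t / s \<le> (t / s) powr \<gamma>\<close>; the shares of \<open>a\<close> and \<open>b\<close> in \<open>a + b\<close> sum to \<open>1\<close>.\<close>

lemma powr_add_le_add_powr:
  fixes a b \<gamma> :: real
  assumes "0 \<le> a" "0 \<le> b" "0 < \<gamma>" "\<gamma> \<le> 1"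
  shows "(a + b) powr \<gamma> \<le> a powr \<gamma> + b powr \<gamma>"
proof (cases "a + b = 0")
  case True
  then show ?thesis using assms by (simp add: add_nonneg_eq_0_iff)
next
  case False
  define s where "s = a + b"
  have s: "s > 0" using False assms by (simp add: s_def)
  have fraction: "t / s * s powr \<gamma> \<le> t powr \<gamma>" if "0 \<le> t" "t \<le> s" for t
  proof (cases "t = 0")
    case False
    with that have t: "0 < t / s" "t / s \<le> 1" using s by auto
    have "t / s \<le> (t / s) powr \<gamma>"
      using powr_mono'[OF assms(4), of "t / s"] t by (simp only: powr_one)
    also have "\<dots> = t powr \<gamma> / s powr \<gamma>"
      using that s by (simp add: powr_divide)
    finally show ?thesis using s by (simp add: field_simps)
  qed (use s in simp)
  have "s powr \<gamma> = a / s * s powr \<gamma> + b / s * s powr \<gamma>"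
    using s by (simp add: s_def flip: distrib_right add_divide_distrib)
  also have "\<dots> \<le> a powr \<gamma> + b powr \<gamma>"
    using assms by (intro add_mono fraction) (auto simp: s_def)
  finally show ?thesis by (simp add: s_def)
qed

lemma power_utility_ennreal [simp]:
  "0 \<le> r \<Longrightarrow> power_utility \<gamma> (ennreal r) = ennreal (r powr \<gamma>)"
  by (simp add: power_utility_def)

lemma power_utility_mono:
  assumes "x \<le> y" "0 \<le> \<gamma>"
  shows "power_utility \<gamma> x \<le> power_utility \<gamma> y"
proof (cases y)
  case (real s)
  then obtain r where r: "x = ennreal r" "0 \<le> r"
    using assms(1) by (cases x) (auto simp: top_unique)
  with real assms show ?thesis
    by (simp add: ennreal_leI powr_mono2)
qed (simp add: power_utility_def)

lemma borel_measurable_power_utility [measurable]: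
  "power_utility \<gamma> \<in> borel_measurable borel"
  unfolding power_utility_def[abs_def] by measurable

lemma power_utility_cmult:
  assumes "0 < c"
  shows "power_utility \<gamma> (ennreal c * x) = ennreal (c powr \<gamma>) * power_utility \<gamma> x"
proof (cases x)
  case (real r)
  with assms show ?thesis
    by (simp add: powr_mult flip: ennreal_mult)
next
  case top
  with assms show ?thesis
    by (simp add: power_utility_def ennreal_mult_eq_top_iff ennreal_mult_top)
qed

lemma power_utility_add_le:
  assumes "0 < \<gamma>" "\<gamma> \<le> 1"
  shows "power_utility \<gamma> (x + y) \<le> power_utility \<gamma> x + power_utility \<gamma> y"
proof (cases x; cases y)
  fix r s assume rs: "x = ennreal r" "0 \<le> r" "y = ennreal s" "0 \<le> s"
  have "ennreal ((r + s) powr \<gamma>) \<le> ennreal (r powr \<gamma> + s powr \<gamma>)"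
    using rs assms by (intro ennreal_leI powr_add_le_add_powr) auto
  with rs show ?thesis by (simp flip: ennreal_plus)
qed (auto simp: power_utility_def)

lemma power_utility_le_add_one:
  assumes "0 < \<gamma>" "\<gamma> \<le> 1"
  shows "power_utility \<gamma> x \<le> 1 + x"
proof (cases x)
  case (real r)
  have "r powr \<gamma> \<le> 1 + r"
  proof (cases "r \<le> 1")
    case True
    then have "r powr \<gamma> \<le> 1" using real assms by (intro powr_le1) auto
    with real show ?thesis by linarith
  next
    case False
    then have "r powr \<gamma> \<le> r powr 1" using assms by (intro powr_mono) auto
    with False show ?thesis by simp
  qed
  then have "ennreal (r powr \<gamma>) \<le> ennreal (1 + r)" by (rule ennreal_leI)
  with real show ?thesis by simp
qed (simp add: power_utility_def)


section \<open>Histories and their shift by one period\<close>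

text \<open>As in \<^const>\<open>history\<close>, a negative state is frozen.\<close>

definition transition :: "int \<Rightarrow> int \<Rightarrow> int \<Rightarrow> int" where
  "transition x a k = (if x \<ge> 0 then x - a + k else x)"

text \<open>The policy seen from time \<open>1\<close> on, with the initial state and the first action kept as the past.
  The state at time \<open>1\<close> reaches it through its own histories.\<close>

definition remaining_policy :: "policy \<Rightarrow> int \<Rightarrow> policy" where
  "remaining_policy \<pi> x = (\<lambda>k h s. \<pi> (Suc k) ((x, \<pi> 0 [] x) # h) s)"

lemma history_cong:
  assumes "\<And>n. z (Suc n) = z' (Suc n)"
  shows "history \<pi> x z k = history \<pi> x z' k"
  by (induction k) (simp_all add: assms Let_def case_prod_beta)

lemma action_cong:
  "(\<And>n. z (Suc n) = z' (Suc n)) \<Longrightarrow> action \<pi> x z k = action \<pi> x z' k"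
  unfolding action_def using history_cong by metis

lemma action_0 [simp]: "action \<pi> x z 0 = \<pi> 0 [] x"
  by (simp add: action_def)

text \<open>The transition from time \<open>n\<close> to \<open>Suc n\<close> reads the noise at \<open>Suc n\<close>, so a noise sequence is written
  as \<open>case_nat c w\<close> with an irrelevant \<open>c\<close>.  Consuming the first relevant value \<open>k\<close> leaves
  \<open>case_nat c w\<close> from \<open>case_nat c (case_nat k w)\<close>.\<close>

lemma history_Suc_shift:
  "history \<pi> x (case_nat c (case_nat k w)) (Suc n) =
     map_prod ((#) (x, \<pi> 0 [] x)) id
       (history (remaining_policy \<pi> x) (transition x (\<pi> 0 [] x) k) (case_nat c w) n)"
proof (induction n)
  case 0
  show ?case by (simp add: transition_def Let_def)
next
  case (Suc n)
  obtain h s where hs: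
    "history (remaining_policy \<pi> x) (transition x (\<pi> 0 [] x) k) (case_nat c w) n = (h, s)"
    by fastforce
  have "remaining_policy \<pi> x n h s = \<pi> (Suc n) ((x, \<pi> 0 [] x) # h) s"
    by (simp add: remaining_policy_def)
  then show ?case
    unfolding history.simps(2)[of _ _ _ "Suc n"] Suc.IH
    by (simp add: hs Let_def)
qed

lemma action_Suc_shift:
  "action \<pi> x (case_nat c (case_nat k w)) (Suc n) =
     action (remaining_policy \<pi> x) (transition x (\<pi> 0 [] x) k) (case_nat c w) n"
  unfolding action_def history_Suc_shift
  by (simp add: remaining_policy_def)

lemma history_admissible:
  assumes "\<pi> \<in> policies"
  shows "length (fst (history \<pi> x z k)) = k \<and> set (fst (history \<pi> x z k)) \<subseteq> admissible_pairs"
proof (induction k)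
  case (Suc k)
  obtain h s where hs: "history \<pi> x z k = (h, s)" by fastforce
  with Suc have "length h = k" "set h \<subseteq> admissible_pairs" by auto
  moreover from this have "\<pi> k h s \<in> actions s"
    using assms by (auto simp: policies_def)
  ultimately show ?case using hs by (auto simp: admissible_pairs_def Let_def)
qed simp

lemma action_in_actions:
  assumes "\<pi> \<in> policies"
  shows "action \<pi> x z k \<in> actions (state \<pi> x z k)"
  using history_admissible[OF assms, of x z k] assms
  by (auto simp: action_def state_def policies_def)

lemma action_nonneg:
  "\<pi> \<in> policies \<Longrightarrow> 0 \<le> action \<pi> x z k"
  using action_in_actions[of \<pi> x z k] by (auto simp: actions_def split: if_splits)

lemma initial_action_in_actions:
  "\<pi> \<in> policies \<Longrightarrow> \<pi> 0 [] x \<in> actions x"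
  using action_in_actions[of \<pi> x "\<lambda>_. 0" 0] by (simp add: state_def)

lemma remaining_policy_in_policies:
  assumes "\<pi> \<in> policies"
  shows "remaining_policy \<pi> x \<in> policies"
proof -
  have "\<pi> (Suc (length h)) ((x, \<pi> 0 [] x) # h) s \<in> actions s"
    if "set h \<subseteq> admissible_pairs" for h s
  proof -
    have "set ((x, \<pi> 0 [] x) # h) \<subseteq> admissible_pairs"
      using that initial_action_in_actions[OF assms] by (simp add: admissible_pairs_def)
    moreover have "length ((x, \<pi> 0 [] x) # h) = Suc (length h)" by simp
    ultimately show ?thesis using assms unfolding policies_def by blast
  qed
  then show ?thesis by (auto simp: policies_def remaining_policy_def)
qed

text \<open>This identity makes the iteration along the generated policy close on itself: its remainder is of
  the same kind, with the updated wealth as initial value.\<close>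

lemma remaining_generated_policy:
  "remaining_policy (generated_policy \<beta> f y) x =
     generated_policy \<beta> f ((y + real_of_int (f x y)) / \<beta>)"
  by (simp add: remaining_policy_def generated_policy_def wealth_def fun_eq_iff)

lemma generated_policy_in_policies:
  assumes "\<And>x y. f x y \<in> actions x"
  shows "generated_policy \<beta> f y \<in> policies"
  using assms by (simp add: policies_def generated_policy_def)

lemma state_negative_absorbing:
  assumes "state \<pi> x z n < 0" "n \<le> m"
  shows "state \<pi> x z m < 0"
  using assms(2)
proof (induction rule: dec_induct)
  case (step k)
  then show ?case by (simp add: state_def Let_def case_prod_beta)
qed (fact assms(1))

text \<open>Ruin is absorbing and the only admissible action in a negative state is \<open>0\<close>, so no dividends
  are missed by stopping the sum at the ruin time.\<close>

lemma dividends_until_ruin_eq_total_dividends: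
  assumes "\<pi> \<in> policies"
  shows "dividends_until_ruin \<beta> \<pi> x z = total_dividends \<beta> \<pi> x z"
  unfolding dividends_until_ruin_def total_dividends_def
proof (intro suminf_cong)
  fix k
  have "action \<pi> x z k = 0" if late: "\<not> enat k < ruin_time \<pi> x z"
  proof -
    \<comment> \<open>A strict bound on an infimum yields a member below the bound, hence \<open>Suc k\<close> in place of \<open>k\<close>.\<close>
    have "\<exists>n\<in>{n. state \<pi> x z n < 0}. enat n < enat (Suc k)"
      using late unfolding ruin_time_def INF_less_iff[symmetric]
      by (simp add: not_less) (metis enat_ord_simps(2) lessI order_le_less_trans)
    then have "state \<pi> x z k < 0" by (auto intro: state_negative_absorbing)
    with action_in_actions[OF assms, of x z k] show ?thesis by (simp add: actions_def)
  qed
  then show "(if enat k < ruin_time \<pi> x z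
        then ennreal (\<beta> ^ k * real_of_int (action \<pi> x z k)) else 0) =
      ennreal (\<beta> ^ k * real_of_int (action \<pi> x z k))"
    by auto
qed

definition dividends_before :: "real \<Rightarrow> policy \<Rightarrow> int \<Rightarrow> nat \<Rightarrow> (nat \<Rightarrow> int) \<Rightarrow> real" where
  "dividends_before \<beta> \<pi> x n z = (\<Sum>k<n. \<beta> ^ k * real_of_int (action \<pi> x z k))"

lemma dividends_before_nonneg:
  "\<pi> \<in> policies \<Longrightarrow> 0 \<le> \<beta> \<Longrightarrow> 0 \<le> dividends_before \<beta> \<pi> x n z"
  unfolding dividends_before_def by (intro sum_nonneg mult_nonneg_nonneg) (auto intro: action_nonneg)

lemma dividends_before_shift:
  "dividends_before \<beta> \<pi> x (Suc n) (case_nat c (case_nat k w)) =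
     real_of_int (\<pi> 0 [] x) + \<beta> * dividends_before \<beta> (remaining_policy \<pi> x)
       (transition x (\<pi> 0 [] x) k) n (case_nat c w)"
  unfolding dividends_before_def sum.lessThan_Suc_shift
  by (simp add: action_Suc_shift sum_distrib_left mult_ac)

lemma ennreal_dividends_before:
  assumes "\<pi> \<in> policies" "0 \<le> \<beta>"
  shows "ennreal (dividends_before \<beta> \<pi> x n z) =
    (\<Sum>k<n. ennreal (\<beta> ^ k * real_of_int (action \<pi> x z k)))"
  unfolding dividends_before_def using assms action_nonneg
  by (subst sum_ennreal) auto

lemma dividends_before_le_total:
  assumes "\<pi> \<in> policies" "0 \<le> \<beta>"
  shows "ennreal (dividends_before \<beta> \<pi> x n z) \<le> total_dividends \<beta> \<pi> x z"
  unfolding ennreal_dividends_before[OF assms] total_dividends_def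
  by (intro sum_le_suminf) auto

lemma total_dividends_shift:
  assumes "\<pi> \<in> policies" "0 < \<beta>"
  shows "total_dividends \<beta> \<pi> x (case_nat c (case_nat k w)) =
    ennreal (real_of_int (\<pi> 0 [] x)) + ennreal \<beta> * total_dividends \<beta> (remaining_policy \<pi> x)
       (transition x (\<pi> 0 [] x) k) (case_nat c w)"
proof -
  let ?g = "\<lambda>n. ennreal (\<beta> ^ n *
    real_of_int (action (remaining_policy \<pi> x) (transition x (\<pi> 0 [] x) k) (case_nat c w) n))"
  let ?f = "\<lambda>n. ennreal (\<beta> ^ n * real_of_int (action \<pi> x (case_nat c (case_nat k w)) n))"
  have "?f (Suc n) = ennreal \<beta> * ?g n" for n
    using assms action_nonneg[OF remaining_policy_in_policies[OF assms(1)]]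
    by (simp add: action_Suc_shift mult_ac flip: ennreal_mult)
  moreover have "(\<Sum>n. ?f n) = ?f 0 + (\<Sum>n. ?f (Suc n))"
    using suminf_offset[OF summableI, of ?f 1] by (simp add: add.commute)
  ultimately show ?thesis
    by (simp add: total_dividends_def)
qed


section \<open>The model driven by an i.i.d. sequence\<close>

text \<open>The noise is realised as the coordinates of a product of copies of \<open>p\<close>, where removing the first
  coordinate leaves a sequence of the same law.\<close>

locale iid_dividend_model =
  fixes p :: "int pmf" and \<beta> \<gamma> :: real
  assumes discount: "0 < \<beta>" "\<beta> < 1"
    and exponent: "0 < \<gamma>" "\<gamma> < 1"
    and mean_finite: "(\<integral>\<^sup>+k. ennreal (real_of_int (max k 0)) \<partial>measure_pmf p) < \<infinity>"
begin

sublocale sequence_space "measure_pmf p" ..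

definition mean_gain :: real where
  "mean_gain = enn2real (\<integral>\<^sup>+k. ennreal (real_of_int (max k 0)) \<partial>measure_pmf p)"

lemma mean_gain_nonneg: "0 \<le> mean_gain"
  by (simp add: mean_gain_def)

lemma nn_integral_gain:
  "(\<integral>\<^sup>+k. ennreal (real_of_int (max k 0)) \<partial>measure_pmf p) = ennreal mean_gain"
  using mean_finite by (simp add: mean_gain_def)

text \<open>The sequences drawn from the product measure are the noise from time \<open>1\<close> on; the value \<open>0\<close> fills
  the index that no transition reads.\<close>

definition expect :: "((nat \<Rightarrow> int) \<Rightarrow> ennreal) \<Rightarrow> ennreal" where
  "expect F = (\<integral>\<^sup>+w. F (case_nat 0 w) \<partial>S)"

lemma component_measurable: "(\<lambda>w. w i) \<in> measurable S (count_space UNIV)"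
  using measurable_component_singleton[of i UNIV "\<lambda>_. measure_pmf p"]
  by simp

text \<open>Arbitrary policies are harmless here: histories take countably many values, and on a countable
  discrete space every function is measurable.\<close>

lemma history_measurable:
  "(\<lambda>w. history \<pi> x (case_nat 0 w) k) \<in> measurable S (count_space UNIV)"
proof (induction k)
  case (Suc k)
  define g where "g = (\<lambda>hs z. let (h, s) = hs; a = \<pi> k h s in
    (h @ [(s, a)], if s \<ge> 0 then s - a + z else s))"
  have "(\<lambda>w. g (history \<pi> x (case_nat 0 w) k) (w k)) \<in> measurable S (count_space UNIV)"
    by (rule measurable_compose_countable[OF _ Suc.IH])
       (rule measurable_compose[OF component_measurable], simp)
  moreover have "history \<pi> x (case_nat 0 w) (Suc k) = g (history \<pi> x (case_nat 0 w) k) (w k)" for w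
    by (simp add: g_def Let_def case_prod_beta)
  ultimately show ?case by (simp only:)
qed simp

lemma action_measurable [measurable]:
  "(\<lambda>w. action \<pi> x (case_nat 0 w) k) \<in> measurable S (count_space UNIV)"
  unfolding action_def
  by (rule measurable_compose[OF history_measurable]) simp

lemma total_dividends_measurable [measurable]:
  "(\<lambda>w. total_dividends \<beta> \<pi> x (case_nat 0 w)) \<in> borel_measurable S"
  unfolding total_dividends_def by measurable

lemma dividends_before_measurable [measurable]:
  "(\<lambda>w. dividends_before \<beta> \<pi> x n (case_nat 0 w)) \<in> borel_measurable S"
  unfolding dividends_before_def by measurable

lemma expect_step:
  assumes [measurable]: "(\<lambda>w. F (case_nat 0 w)) \<in> borel_measurable S"
  shows "expect F = (\<integral>\<^sup>+k. \<integral>\<^sup>+w. F (case_nat 0 (case_nat k w)) \<partial>S \<partial>measure_pmf p)"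
proof -
  have [measurable]: "(\<lambda>(s, w). case_nat s w) \<in> measurable (measure_pmf p \<Otimes>\<^sub>M S) S"
    by measurable
  have "expect F = (\<integral>\<^sup>+w. F (case_nat 0 w) \<partial>distr (measure_pmf p \<Otimes>\<^sub>M S) S (\<lambda>(s, w). case_nat s w))"
    by (simp only: expect_def PiM_iter)
  also have "\<dots> = (\<integral>\<^sup>+(k, w). F (case_nat 0 (case_nat k w)) \<partial>(measure_pmf p \<Otimes>\<^sub>M S))"
    by (subst nn_integral_distr) (simp_all add: case_prod_beta')
  also have "\<dots> = (\<integral>\<^sup>+k. \<integral>\<^sup>+w. F (case_nat 0 (case_nat k w)) \<partial>S \<partial>measure_pmf p)"
    by (subst P.nn_integral_fst[symmetric]) (simp_all add: case_prod_beta')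
  finally show ?thesis .
qed

lemma transition_max_le:
  assumes "a \<in> actions x"
  shows "real_of_int (max (transition x a k) 0) \<le>
    real_of_int (max x 0) - real_of_int a + real_of_int (max k 0)"
  using assms by (auto simp: actions_def transition_def max_def split: if_splits)

lemma actions_bounds:
  assumes "a \<in> actions x"
  shows "0 \<le> a" "a \<le> max x 0"
  using assms by (auto simp: actions_def split: if_splits)

text \<open>A dividend \<open>a\<close> costs the same amount of the state, which is the only resource besides the gains
  \<open>Z\<^sup>+\<close>.  With \<open>B = \<beta> * E Z\<^sup>+ / (1 - \<beta>)\<close>, the solution of \<open>B = \<beta> * B + \<beta> * E Z\<^sup>+\<close>, the bound
  \<open>x\<^sup>+ + B\<close> reproduces itself in the recursion over one period.\<close>

lemma expect_dividends_before_le: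
  assumes "\<pi> \<in> policies"
  shows "expect (\<lambda>z. ennreal (dividends_before \<beta> \<pi> x n z)) \<le>
    ennreal (real_of_int (max x 0) + \<beta> * mean_gain / (1 - \<beta>))"
  using assms
proof (induction n arbitrary: \<pi> x)
  case 0
  show ?case by (simp add: expect_def dividends_before_def)
next
  case (Suc n)
  define B where "B = \<beta> * mean_gain / (1 - \<beta>)"
  have B: "0 \<le> B" "B = \<beta> * B + \<beta> * mean_gain"
    using discount mean_gain_nonneg by (simp_all add: B_def field_simps)
  define a where "a = real_of_int (\<pi> 0 [] x)"
  define X where "X = real_of_int (max x 0)"
  have action: "\<pi> 0 [] x \<in> actions x" using Suc.prems by (rule initial_action_in_actions)
  then have a: "0 \<le> a" "a \<le> X" using actions_bounds[OF action] by (auto simp: a_def X_def)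
  let ?\<pi> = "remaining_policy \<pi> x" and ?x = "transition x (\<pi> 0 [] x)"
  note remaining = remaining_policy_in_policies[OF Suc.prems, of x]
  have "expect (\<lambda>z. ennreal (dividends_before \<beta> \<pi> x (Suc n) z)) =
    (\<integral>\<^sup>+k. \<integral>\<^sup>+w. ennreal (a + \<beta> * dividends_before \<beta> ?\<pi> (?x k) n (case_nat 0 w)) \<partial>S \<partial>measure_pmf p)"
    by (subst expect_step) (simp_all add: dividends_before_shift a_def)
  also have "\<dots> = (\<integral>\<^sup>+k. ennreal a + ennreal \<beta> *
      expect (\<lambda>z. ennreal (dividends_before \<beta> ?\<pi> (?x k) n z)) \<partial>measure_pmf p)"
  proof -
    have "ennreal (a + \<beta> * dividends_before \<beta> ?\<pi> (?x k) n z) =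
        ennreal a + ennreal \<beta> * ennreal (dividends_before \<beta> ?\<pi> (?x k) n z)" for k z
      using a discount dividends_before_nonneg[OF remaining] by (simp add: ennreal_mult)
    then show ?thesis
      by (simp add: expect_def nn_integral_add nn_integral_cmult P.emeasure_space_1)
  qed
  also have "\<dots> \<le> (\<integral>\<^sup>+k. ennreal (a + \<beta> * (X - a + B)) + ennreal \<beta> * ennreal (real_of_int (max k 0)) \<partial>measure_pmf p)"
  proof (intro nn_integral_mono)
    fix k
    have "expect (\<lambda>z. ennreal (dividends_before \<beta> ?\<pi> (?x k) n z)) \<le> ennreal (real_of_int (max (?x k) 0) + B)"
      unfolding B_def by (rule Suc.IH[OF remaining])
    also have "\<dots> \<le> ennreal (X - a + B + real_of_int (max k 0))"
      using transition_max_le[OF action, of k] by (intro ennreal_leI) (simp add: X_def a_def)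
    finally have "ennreal a + ennreal \<beta> * expect (\<lambda>z. ennreal (dividends_before \<beta> ?\<pi> (?x k) n z)) \<le>
        ennreal a + ennreal \<beta> * ennreal (X - a + B + real_of_int (max k 0))"
      by (intro add_left_mono mult_left_mono) auto
    also have "\<dots> = ennreal (a + \<beta> * (X - a + B)) + ennreal \<beta> * ennreal (real_of_int (max k 0))"
      using a B discount by (simp add: ennreal_mult distrib_left add_ac flip: ennreal_plus ennreal_mult)
    finally show "ennreal a + ennreal \<beta> * expect (\<lambda>z. ennreal (dividends_before \<beta> ?\<pi> (?x k) n z)) \<le>
        ennreal (a + \<beta> * (X - a + B)) + ennreal \<beta> * ennreal (real_of_int (max k 0))" .
  qed
  also have "\<dots> = ennreal (a + \<beta> * (X - a + B) + \<beta> * mean_gain)"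
  proof -
    have "0 \<le> a + \<beta> * (X - a + B)" "0 \<le> \<beta> * mean_gain"
      using a B discount mean_gain_nonneg by simp_all
    then show ?thesis
      using discount mean_gain_nonneg
      by (simp add: nn_integral_add nn_integral_cmult nn_integral_gain
          measure_pmf.emeasure_space_1 ennreal_plus ennreal_mult)
  qed
  also have "\<dots> \<le> ennreal (X + B)"
  proof (rule ennreal_leI)
    have "(1 - \<beta>) * a \<le> (1 - \<beta>) * X" using a discount by (intro mult_left_mono) auto
    then show "a + \<beta> * (X - a + B) + \<beta> * mean_gain \<le> X + B"
      using B(2) by (simp add: algebra_simps)
  qed
  finally show ?case by (simp add: X_def B_def)
qed

lemma expect_total_dividends_le:
  assumes "\<pi> \<in> policies"
  shows "expect (total_dividends \<beta> \<pi> x) \<le>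
    ennreal (real_of_int (max x 0) + \<beta> * mean_gain / (1 - \<beta>))"
proof -
  let ?d = "\<lambda>k w. ennreal (\<beta> ^ k * real_of_int (action \<pi> x (case_nat 0 w) k))"
  have "expect (total_dividends \<beta> \<pi> x) = (\<Sum>k. \<integral>\<^sup>+w. ?d k w \<partial>S)"
    unfolding expect_def total_dividends_def by (rule nn_integral_suminf) measurable
  also have "\<dots> \<le> ennreal (real_of_int (max x 0) + \<beta> * mean_gain / (1 - \<beta>))"
  proof (rule suminf_le_const[OF summableI])
    fix n
    have "(\<Sum>k<n. \<integral>\<^sup>+w. ?d k w \<partial>S) = expect (\<lambda>z. ennreal (dividends_before \<beta> \<pi> x n z))"
      unfolding expect_def using assms discount
      by (simp add: ennreal_dividends_before nn_integral_sum)
    also note expect_dividends_before_le[OF assms]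
    finally show "(\<Sum>k<n. \<integral>\<^sup>+w. ?d k w \<partial>S) \<le> ennreal (real_of_int (max x 0) + \<beta> * mean_gain / (1 - \<beta>))" .
  qed
  finally show ?thesis .
qed

definition policy_value :: "policy \<Rightarrow> int \<Rightarrow> real \<Rightarrow> ennreal" where
  "policy_value \<pi> x y = expect (\<lambda>z. power_utility \<gamma> (total_dividends \<beta> \<pi> x z + ennreal y))"

definition optimal_value :: "int \<Rightarrow> real \<Rightarrow> ennreal" where
  "optimal_value x y = (SUP \<pi>\<in>policies. policy_value \<pi> x y)"

text \<open>The maximand that defines \<^const>\<open>f_star\<close>, extended to negative states by the frozen transition.\<close>

definition bellman :: "int \<Rightarrow> real \<Rightarrow> int \<Rightarrow> ennreal" where
  "bellman x y a = ennreal (\<beta> powr \<gamma>) *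
     (\<integral>\<^sup>+k. optimal_value (transition x a k) ((real_of_int a + y) / \<beta>) \<partial>measure_pmf p)"

lemma policy_value_step:
  assumes "\<pi> \<in> policies" "0 \<le> y"
  shows "policy_value \<pi> x y = ennreal (\<beta> powr \<gamma>) *
    (\<integral>\<^sup>+k. policy_value (remaining_policy \<pi> x) (transition x (\<pi> 0 [] x) k)
       ((real_of_int (\<pi> 0 [] x) + y) / \<beta>) \<partial>measure_pmf p)"
proof -
  define a where "a = real_of_int (\<pi> 0 [] x)"
  let ?D = "\<lambda>k w. total_dividends \<beta> (remaining_policy \<pi> x) (transition x (\<pi> 0 [] x) k) (case_nat 0 w)"
  have "\<pi> 0 [] x \<in> actions x" using assms by (simp add: initial_action_in_actions)
  then have a: "0 \<le> a" using actions_bounds(1) by (simp add: a_def)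
  have "policy_value \<pi> x y = (\<integral>\<^sup>+k. \<integral>\<^sup>+w. power_utility \<gamma> (ennreal a + ennreal \<beta> * ?D k w + ennreal y) \<partial>S \<partial>measure_pmf p)"
    unfolding policy_value_def
    by (subst expect_step) (simp_all add: total_dividends_shift[OF assms(1) discount(1)] a_def)
  also have "\<dots> = (\<integral>\<^sup>+k. \<integral>\<^sup>+w. ennreal (\<beta> powr \<gamma>) *
      power_utility \<gamma> (?D k w + ennreal ((a + y) / \<beta>)) \<partial>S \<partial>measure_pmf p)"
  proof (intro nn_integral_cong)
    fix k w
    have "ennreal \<beta> * ennreal ((a + y) / \<beta>) = ennreal a + ennreal y"
      using a assms discount by (simp flip: ennreal_mult)
    then have "ennreal a + ennreal \<beta> * ?D k w + ennreal y = ennreal \<beta> * (?D k w + ennreal ((a + y) / \<beta>))"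
      by (simp add: distrib_left add_ac)
    then show "power_utility \<gamma> (ennreal a + ennreal \<beta> * ?D k w + ennreal y) =
      ennreal (\<beta> powr \<gamma>) * power_utility \<gamma> (?D k w + ennreal ((a + y) / \<beta>))"
      using discount by (simp add: power_utility_cmult)
  qed
  also have "\<dots> = ennreal (\<beta> powr \<gamma>) * (\<integral>\<^sup>+k. policy_value (remaining_policy \<pi> x)
      (transition x (\<pi> 0 [] x) k) ((a + y) / \<beta>) \<partial>measure_pmf p)"
    by (simp add: policy_value_def expect_def nn_integral_cmult)
  finally show ?thesis by (simp add: a_def)
qed

lemma policy_value_le_bellman:
  assumes "\<pi> \<in> policies" "0 \<le> y"
  shows "policy_value \<pi> x y \<le> bellman x y (\<pi> 0 [] x)"
  unfolding policy_value_step[OF assms] bellman_def optimal_value_def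
  using remaining_policy_in_policies[OF assms(1)]
  by (intro mult_left_mono nn_integral_mono SUP_upper) auto

text \<open>The estimate has to contain \<open>y\<close> only through \<open>y powr \<gamma>\<close>: a linear term in \<open>y\<close> would be multiplied
  by \<open>\<beta> powr -n\<close> after \<open>n\<close> periods and could not be beaten by \<open>(\<beta> powr \<gamma>) ^ n\<close>.\<close>

lemma policy_value_le:
  assumes "\<pi> \<in> policies" "0 \<le> y"
  shows "policy_value \<pi> x y \<le>
    ennreal (y powr \<gamma>) + ennreal (1 + \<beta> * mean_gain / (1 - \<beta>) + real_of_int (max x 0))"
proof -
  have "policy_value \<pi> x y \<le> (\<integral>\<^sup>+w. ennreal (y powr \<gamma>) + (1 + total_dividends \<beta> \<pi> x (case_nat 0 w)) \<partial>S)"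
    unfolding policy_value_def expect_def
  proof (intro nn_integral_mono)
    fix w
    let ?D = "total_dividends \<beta> \<pi> x (case_nat 0 w)"
    have "power_utility \<gamma> (?D + ennreal y) \<le> power_utility \<gamma> ?D + power_utility \<gamma> (ennreal y)"
      using exponent by (intro power_utility_add_le) auto
    also have "\<dots> \<le> (1 + ?D) + ennreal (y powr \<gamma>)"
      using exponent assms by (intro add_mono power_utility_le_add_one) auto
    finally show "power_utility \<gamma> (?D + ennreal y) \<le> ennreal (y powr \<gamma>) + (1 + ?D)"
      by (simp add: add.commute)
  qed
  also have "\<dots> = ennreal (y powr \<gamma>) + (1 + expect (total_dividends \<beta> \<pi> x))"
    by (simp add: expect_def nn_integral_add P.emeasure_space_1)
  also have "\<dots> \<le> ennreal (y powr \<gamma>) + (ennreal 1 + ennreal (real_of_int (max x 0) + \<beta> * mean_gain / (1 - \<beta>)))"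
    using expect_total_dividends_le[OF assms(1)] by (intro add_mono) auto
  also have "\<dots> = ennreal (y powr \<gamma>) + ennreal (1 + \<beta> * mean_gain / (1 - \<beta>) + real_of_int (max x 0))"
    using discount mean_gain_nonneg by (subst ennreal_plus[symmetric]) (auto simp: add_ac)
  finally show ?thesis .
qed

context
  fixes f :: "int \<Rightarrow> real \<Rightarrow> int"
  assumes f_admissible: "\<And>x y. f x y \<in> actions x"
    and f_maximises: "\<And>x y a. 0 \<le> y \<Longrightarrow> a \<in> actions x \<Longrightarrow> bellman x y a \<le> bellman x y (f x y)"
begin

lemma optimal_value_le_bellman_maximiser:
  assumes "0 \<le> y"
  shows "optimal_value x y \<le> bellman x y (f x y)"
  unfolding optimal_value_def
proof (rule SUP_least)
  fix \<pi> assume \<pi>: "\<pi> \<in> policies"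
  then have "\<pi> 0 [] x \<in> actions x" by (rule initial_action_in_actions)
  with \<pi> show "policy_value \<pi> x y \<le> bellman x y (f x y)"
    using policy_value_le_bellman[OF \<pi> assms] f_maximises[OF assms] by (meson order_trans)
qed

text \<open>Induction on the number of periods, splitting off the first one.  The factor \<open>\<beta> powr \<gamma>\<close> of the Bellman
  operator rescales the utility of the remaining \<open>n\<close> dividends to that of \<open>Suc n\<close> dividends, and it
  supplies the next power in front of the remainder; the expected positive part of the state grows by at most \<open>E Z\<^sup>+\<close> per period.\<close>

lemma optimal_value_le_truncated:
  assumes "0 \<le> y"
  shows "optimal_value x y \<le>
    expect (\<lambda>z. power_utility \<gamma> (ennreal (dividends_before \<beta> (generated_policy \<beta> f y) x n z + y))) +
    ennreal ((\<beta> powr \<gamma>) ^ n *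
      (1 + \<beta> * mean_gain / (1 - \<beta>) + real_of_int (max x 0) + real n * mean_gain))"
  using assms
proof (induction n arbitrary: x y)
  case 0
  show ?case unfolding optimal_value_def
    using policy_value_le[OF _ 0, of _ x] 0
    by (intro SUP_least) (simp add: expect_def dividends_before_def P.emeasure_space_1)
next
  case (Suc n)
  define c where "c = \<beta> powr \<gamma>"
  define K where "K = 1 + \<beta> * mean_gain / (1 - \<beta>)"
  define a where "a = f x y"
  define y' where "y' = (real_of_int a + y) / \<beta>"
  define X where "X = real_of_int (max x 0)"
  define R where "R = K + X + real n * mean_gain"
  have action: "a \<in> actions x" by (simp add: a_def f_admissible)
  note a = actions_bounds[OF action]
  have c: "0 < c" using discount by (simp add: c_def)
  have K: "0 \<le> K" using discount mean_gain_nonneg by (simp add: K_def)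
  have X: "0 \<le> X" by (simp add: X_def)
  have R: "0 \<le> R" using K X mean_gain_nonneg by (simp add: R_def)
  have y': "0 \<le> y'" using a Suc.prems discount by (simp add: y'_def)
  let ?\<pi> = "generated_policy \<beta> f y"
  let ?U = "\<lambda>k w. power_utility \<gamma> (ennreal (dividends_before \<beta> (generated_policy \<beta> f y')
      (transition x a k) n (case_nat 0 w) + y'))"
  have policies: "generated_policy \<beta> f t \<in> policies" for t
    by (rule generated_policy_in_policies[OF f_admissible])
  have first: "?\<pi> 0 [] x = a" by (simp add: generated_policy_def wealth_def a_def)
  have remaining: "remaining_policy ?\<pi> x = generated_policy \<beta> f y'"
    by (simp add: remaining_generated_policy y'_def a_def add.commute)
  have "optimal_value x y \<le> ennreal c * (\<integral>\<^sup>+k. optimal_value (transition x a k) y' \<partial>measure_pmf p)"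
    using optimal_value_le_bellman_maximiser[OF Suc.prems]
    by (simp add: bellman_def c_def y'_def a_def)
  also have "\<dots> \<le> ennreal c * (\<integral>\<^sup>+k. (\<integral>\<^sup>+w. ?U k w \<partial>S) +
      (ennreal (c ^ n * R) + ennreal (c ^ n) * ennreal (real_of_int (max k 0))) \<partial>measure_pmf p)"
  proof (intro mult_left_mono nn_integral_mono)
    fix k
    have "optimal_value (transition x a k) y' \<le> (\<integral>\<^sup>+w. ?U k w \<partial>S) +
        ennreal (c ^ n * (K + real_of_int (max (transition x a k) 0) + real n * mean_gain))"
      using Suc.IH[OF y'] by (simp add: expect_def c_def K_def)
    also have "ennreal (c ^ n * (K + real_of_int (max (transition x a k) 0) + real n * mean_gain)) \<le>
        ennreal (c ^ n * (R + real_of_int (max k 0)))"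
      using transition_max_le[OF action, of k] a c
      by (intro ennreal_leI mult_left_mono) (auto simp: R_def X_def)
    also have "\<dots> = ennreal (c ^ n * R) + ennreal (c ^ n) * ennreal (real_of_int (max k 0))"
      using c R by (simp add: distrib_left flip: ennreal_plus ennreal_mult)
    finally show "optimal_value (transition x a k) y' \<le> (\<integral>\<^sup>+w. ?U k w \<partial>S) +
      (ennreal (c ^ n * R) + ennreal (c ^ n) * ennreal (real_of_int (max k 0)))"
      by (simp add: add_mono)
  qed simp
  also have "\<dots> = (\<integral>\<^sup>+k. \<integral>\<^sup>+w. ennreal c * ?U k w \<partial>S \<partial>measure_pmf p) +
      ennreal (c * (c ^ n * R + c ^ n * mean_gain))"
    using c R mean_gain_nonneg
    by (simp add: nn_integral_add nn_integral_cmult nn_integral_gain measure_pmf.emeasure_space_1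
        distrib_left ennreal_mult)
  also have "(\<integral>\<^sup>+k. \<integral>\<^sup>+w. ennreal c * ?U k w \<partial>S \<partial>measure_pmf p) =
      expect (\<lambda>z. power_utility \<gamma> (ennreal (dividends_before \<beta> ?\<pi> x (Suc n) z + y)))"
  proof -
    have "ennreal c * ?U k w = power_utility \<gamma>
        (ennreal (dividends_before \<beta> ?\<pi> x (Suc n) (case_nat 0 (case_nat k w)) + y))" for k w
    proof -
      let ?d = "dividends_before \<beta> (generated_policy \<beta> f y') (transition x a k) n (case_nat 0 w)"
      have "0 \<le> ?d" using dividends_before_nonneg[OF policies] discount by simp
      moreover have "\<beta> * y' = real_of_int a + y" using discount by (simp add: y'_def)
      moreover from this have "dividends_before \<beta> ?\<pi> x (Suc n) (case_nat 0 (case_nat k w)) + y =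
          \<beta> * (?d + y')"
        unfolding dividends_before_shift first remaining by (simp add: distrib_left)
      ultimately have "ennreal (dividends_before \<beta> ?\<pi> x (Suc n) (case_nat 0 (case_nat k w)) + y) =
          ennreal \<beta> * ennreal (?d + y')"
        using y' discount by (simp add: ennreal_mult)
      then show ?thesis using discount by (simp add: power_utility_cmult c_def)
    qed
    then show ?thesis by (subst expect_step) simp_all
  qed
  also have "c * (c ^ n * R + c ^ n * mean_gain) = c ^ Suc n * (K + X + real (Suc n) * mean_gain)"
    by (simp add: R_def algebra_simps)
  finally show ?case by (simp add: c_def K_def X_def)
qed

theorem generated_policy_attains_optimal_value:
  assumes "0 \<le> y"
  shows "policy_value (generated_policy \<beta> f y) x y = optimal_value x y"
proof (rule antisym)
  let ?\<pi> = "generated_policy \<beta> f y"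
  have \<pi>: "?\<pi> \<in> policies"
    by (rule generated_policy_in_policies[OF f_admissible])
  then show "policy_value ?\<pi> x y \<le> optimal_value x y"
    unfolding optimal_value_def by (rule SUP_upper)
  define c where "c = \<beta> powr \<gamma>"
  define C where "C = 1 + \<beta> * mean_gain / (1 - \<beta>) + real_of_int (max x 0)"
  have c: "0 < c" "c < 1"
    using discount exponent powr_less_mono2[of \<gamma> \<beta> 1] by (auto simp: c_def)
  have bound: "optimal_value x y \<le> policy_value ?\<pi> x y + ennreal (c ^ n * (C + real n * mean_gain))" for n
  proof -
    have "power_utility \<gamma> (ennreal (dividends_before \<beta> ?\<pi> x n z + y)) \<le>
        power_utility \<gamma> (total_dividends \<beta> ?\<pi> x z + ennreal y)" for z
      using dividends_before_le_total[OF \<pi>] dividends_before_nonneg[OF \<pi>] discount assms exponent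
      by (intro power_utility_mono) (auto simp: add_mono)
    then have "expect (\<lambda>z. power_utility \<gamma> (ennreal (dividends_before \<beta> ?\<pi> x n z + y))) \<le> policy_value ?\<pi> x y"
      unfolding policy_value_def expect_def by (intro nn_integral_mono)
    with optimal_value_le_truncated[OF assms, of x n] show ?thesis
      unfolding c_def C_def by (meson add_right_mono order_trans)
  qed
  have "(\<lambda>n. c ^ n * C + real n * c ^ n * mean_gain) \<longlonglongrightarrow> 0 * C + 0 * mean_gain"
    using c by (intro tendsto_intros LIMSEQ_power_zero powser_times_n_limit_0) auto
  then have "(\<lambda>n. c ^ n * (C + real n * mean_gain)) \<longlonglongrightarrow> 0"
    by (simp add: algebra_simps)
  then have "(\<lambda>n. policy_value ?\<pi> x y + ennreal (c ^ n * (C + real n * mean_gain)))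
      \<longlonglongrightarrow> policy_value ?\<pi> x y + ennreal 0"
    by (intro tendsto_intros)
  then show "optimal_value x y \<le> policy_value ?\<pi> x y"
    using bound by (intro LIMSEQ_le_const) auto
qed

end

end


section \<open>Transfer to a given probability space\<close>

lemma infsum_int_ennreal_eq_nn_integral:
  fixes f :: "int \<Rightarrow> ennreal"
  shows "(\<Sum>\<^sub>\<infinity>k\<in>UNIV. f k) = (\<integral>\<^sup>+k. f k \<partial>count_space UNIV)"
proof -
  have bij: "bij (int_decode :: nat \<Rightarrow> int)" by (rule bij_int_decode)
  have "(\<Sum>\<^sub>\<infinity>k\<in>UNIV. f k) = (\<Sum>\<^sub>\<infinity>n\<in>UNIV. f (int_decode n))"
    using infsum_reindex_bij_betw[OF bij, of f] by simp
  also have "\<dots> = (\<Sum>n. f (int_decode n))"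
    by (intro sums_unique has_sum_imp_sums has_sum_infsum nonneg_summable_on_complete) auto
  also have "\<dots> = (\<integral>\<^sup>+n. f (int_decode n) \<partial>count_space UNIV)"
    by (simp add: nn_integral_count_space_nat)
  also have "\<dots> = (\<integral>\<^sup>+k. f k \<partial>count_space UNIV)"
    by (rule nn_integral_bij_count_space[OF bij])
  finally show ?thesis .
qed

text \<open>The points of the integers carry the law of each \<open>Z n\<close>, so the common point masses determine a
  common law; independence of the whole sequence then says that the joint law is the product.  The
  index starts at \<open>1\<close>, hence the shift by \<open>Suc\<close>.\<close>

lemma (in prob_space) iid_sequence_law:
  assumes indep: "indep_vars (\<lambda>_. count_space UNIV) Z {1::nat..}"
    and law: "\<And>n k. n \<ge> 1 \<Longrightarrow> measure M {\<omega> \<in> space M. Z n \<omega> = k} = q k"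
  obtains p :: "int pmf" where "\<And>k. pmf p k = q k"
    and "distr M (count_space UNIV) (Z 1) = measure_pmf p"
    and "(\<lambda>\<omega> n. Z (Suc n) \<omega>) \<in> measurable M (PiM UNIV (\<lambda>_. measure_pmf p))"
    and "distr M (PiM UNIV (\<lambda>_. measure_pmf p)) (\<lambda>\<omega> n. Z (Suc n) \<omega>) = PiM UNIV (\<lambda>_. measure_pmf p)"
proof -
  have rv: "random_variable (count_space UNIV) (Z n)" if "n \<ge> 1" for n
    using indep that by (auto simp: indep_vars_def)
  have point: "emeasure (distr M (count_space UNIV) (Z n)) {k} = ennreal (q k)" if "n \<ge> 1" for n k
    using rv[OF that] law[OF that, of k]
    by (simp add: emeasure_distr emeasure_eq_measure vimage_def Int_def conj_commute)
  have laws: "distr M (count_space UNIV) (Z n) = distr M (count_space UNIV) (Z 1)" if "n \<ge> 1" for n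
    by (rule measure_eqI_countable[of _ UNIV]) (use that point in auto)
  interpret Z1: prob_space "distr M (count_space UNIV) (Z 1)"
    by (rule prob_space_distr) (simp add: rv)
  have q_nonneg: "0 \<le> q k" for k using law[of 1 k] by (metis measure_nonneg order_refl)
  have "(\<integral>\<^sup>+k. ennreal (q k) \<partial>count_space UNIV) = emeasure (distr M (count_space UNIV) (Z 1)) UNIV"
    by (subst emeasure_countable_singleton) (simp_all add: point)
  also have "\<dots> = 1" using Z1.emeasure_space_1 by simp
  finally have q_sum: "(\<integral>\<^sup>+k. ennreal (q k) \<partial>count_space UNIV) = 1" .
  define p where "p = embed_pmf q"
  have p: "pmf p k = q k" for k
    unfolding p_def by (rule pmf_embed_pmf[OF q_nonneg q_sum])
  have Z1: "distr M (count_space UNIV) (Z 1) = measure_pmf p"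
    by (rule measure_eqI_countable[of _ UNIV]) (auto simp: point[of 1, simplified] emeasure_pmf_single p)
  let ?C = "PiM UNIV (\<lambda>_::nat. count_space (UNIV :: int set))"
  have sets_S: "sets (PiM UNIV (\<lambda>_::nat. measure_pmf p)) = sets ?C"
    by (intro sets_PiM_cong) auto
  have "indep_vars (\<lambda>_. count_space UNIV) (\<lambda>n. Z (Suc n)) UNIV"
    unfolding indep_vars_def2
  proof (intro conjI ballI indep_setsI)
    fix n show "random_variable (count_space UNIV) (Z (Suc n))" by (simp add: rv)
  next
    fix n show "{Z (Suc n) -` A \<inter> space M |A. A \<in> sets (count_space UNIV)} \<subseteq> events"
      using rv[of "Suc n"] by (auto intro: measurable_sets)
  next
    fix A :: "nat \<Rightarrow> 'a set" and J
    assume J: "J \<noteq> {}" "finite J"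
      "\<forall>j\<in>J. A j \<in> {Z (Suc j) -` A \<inter> space M |A. A \<in> sets (count_space UNIV)}"
    have "indep_sets (\<lambda>n. {Z n -` A \<inter> space M |A. A \<in> sets (count_space UNIV)}) {1..}"
      using indep by (simp add: indep_vars_def2)
    then have "prob (\<Inter>i\<in>Suc ` J. A (i - 1)) = (\<Prod>i\<in>Suc ` J. prob (A (i - 1)))"
      using J by (intro indep_setsD[of _ "{1..}"]) auto
    then show "prob (\<Inter>j\<in>J. A j) = (\<Prod>j\<in>J. prob (A j))"
      by (simp add: prod.reindex)
  qed
  then have "distr M ?C (\<lambda>\<omega>. \<lambda>n\<in>UNIV. Z (Suc n) \<omega>) =
      PiM UNIV (\<lambda>n. distr M (count_space UNIV) (Z (Suc n)))"
    by (subst (asm) indep_vars_iff_distr_eq_PiM') (auto simp: rv)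
  moreover have "distr M (count_space UNIV) (Z (Suc n)) = measure_pmf p" for n
    using laws[of "Suc n"] by (simp add: Z1[simplified])
  ultimately have "distr M ?C (\<lambda>\<omega> n. Z (Suc n) \<omega>) = PiM UNIV (\<lambda>_. measure_pmf p)"
    by (simp add: restrict_def)
  moreover have "distr M (PiM UNIV (\<lambda>_. measure_pmf p)) (\<lambda>\<omega> n. Z (Suc n) \<omega>) = distr M ?C (\<lambda>\<omega> n. Z (Suc n) \<omega>)"
    by (intro distr_cong) (auto simp: sets_S)
  moreover have "(\<lambda>\<omega> n. Z (Suc n) \<omega>) \<in> measurable M (PiM UNIV (\<lambda>_. measure_pmf p))"
    unfolding measurable_cong_sets[OF refl sets_S]
    by (rule measurable_PiM_single') (auto simp: rv)
  ultimately show ?thesis using p Z1 by (intro that[of p]) simp_all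
qed

theorem corollary4p11:
  fixes M :: "'w measure"
    and Z :: "nat \<Rightarrow> 'w \<Rightarrow> int"
    and q :: "int \<Rightarrow> real"
    and \<beta> \<gamma> :: real
  assumes "prob_space M"
    and "prob_space.indep_vars M (\<lambda>_. count_space UNIV) Z {1..}"
    and "\<And>n k. n \<ge> 1 \<Longrightarrow> measure M {\<omega> \<in> space M. Z n \<omega> = k} = q k"
    and "integrable M (\<lambda>\<omega>. real_of_int (max (Z 1 \<omega>) 0))"
    and "measure M {\<omega> \<in> space M. Z 1 \<omega> < 0} > 0"
    and "0 < \<beta>" "\<beta> < 1"
    and "0 < \<gamma>" "\<gamma> < 1"
  defines "\<pi>\<^sub>s \<equiv> generated_policy \<beta> (f_star M Z q \<beta> \<gamma>) 0"
  shows "\<pi>\<^sub>s \<in> policies \<and>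
         (\<forall>x. J_hat M Z \<beta> \<gamma> x = J_hat_policy M Z \<beta> \<gamma> \<pi>\<^sub>s x)"
proof -
  interpret prob_space M by fact
  obtain p where p: "\<And>k. pmf p k = q k"
    and Z1: "distr M (count_space UNIV) (Z 1) = measure_pmf p"
    and meas: "(\<lambda>\<omega> n. Z (Suc n) \<omega>) \<in> measurable M (PiM UNIV (\<lambda>_. measure_pmf p))"
    and law: "distr M (PiM UNIV (\<lambda>_. measure_pmf p)) (\<lambda>\<omega> n. Z (Suc n) \<omega>) = PiM UNIV (\<lambda>_. measure_pmf p)"
    using iid_sequence_law[OF assms(2,3)] by blast
  have rv: "Z 1 \<in> measurable M (count_space UNIV)"
    using assms(2) by (auto simp: indep_vars_def)
  interpret model: iid_dividend_model p \<beta> \<gamma>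
  proof
    have "(\<integral>\<^sup>+k. ennreal (real_of_int (max k 0)) \<partial>measure_pmf p) =
        (\<integral>\<^sup>+\<omega>. ennreal (real_of_int (max (Z 1 \<omega>) 0)) \<partial>M)"
      unfolding Z1[symmetric] by (subst nn_integral_distr[OF rv]) simp_all
    then show "(\<integral>\<^sup>+k. ennreal (real_of_int (max k 0)) \<partial>measure_pmf p) < \<infinity>"
      using assms(4) by (simp add: real_integrable_def top.not_eq_extremum)
  qed (use assms in auto)
  have expected: "(\<integral>\<^sup>+\<omega>. power_utility \<gamma> (total_dividends \<beta> \<pi> x (\<lambda>n. Z n \<omega>) + ennreal y) \<partial>M) =
      model.policy_value \<pi> x y" for \<pi> x y
  proof -
    have "total_dividends \<beta> \<pi> x (\<lambda>n. Z n \<omega>) = total_dividends \<beta> \<pi> x (case_nat 0 (\<lambda>n. Z (Suc n) \<omega>))" for \<omega>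
      unfolding total_dividends_def
      using action_cong[of "\<lambda>n. Z n \<omega>" "case_nat 0 (\<lambda>n. Z (Suc n) \<omega>)"] by simp
    then show ?thesis
      unfolding model.policy_value_def model.expect_def
      by (subst law[symmetric], subst nn_integral_distr[OF meas]) simp_all
  qed
  have J: "J M Z \<beta> \<gamma> x y = model.optimal_value x y" for x y
    unfolding J_def model.optimal_value_def
    by (intro SUP_cong) (simp_all add: dividends_until_ruin_eq_total_dividends expected)
  have J_hat_policy: "J_hat_policy M Z \<beta> \<gamma> \<pi> x = model.policy_value \<pi> x 0" for \<pi> x
    using expected[of \<pi> x 0] by (simp add: J_hat_policy_def)
  have G: "ennreal (\<beta> powr \<gamma>) * G M Z q \<beta> \<gamma> (x - a) ((real_of_int a + y) / \<beta>) = model.bellman x y a"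
    if "0 \<le> x" for x y a
    unfolding G_def model.bellman_def infsum_int_ennreal_eq_nn_integral J nn_integral_measure_pmf p
    using that by (simp add: transition_def mult.commute)
  let ?f = "f_star M Z q \<beta> \<gamma>"
  have f: "?f x y \<in> actions x \<and> (\<forall>b\<in>actions x. model.bellman x y b \<le> model.bellman x y (?f x y))" for x y
  proof (cases "x \<ge> 0")
    case True
    let ?A = "{a \<in> actions x. \<forall>b\<in>actions x. model.bellman x y b \<le> model.bellman x y a}"
    have fin: "finite (actions x)" "actions x \<noteq> {}" using True by (auto simp: actions_def)
    then have "Max (model.bellman x y ` actions x) \<in> model.bellman x y ` actions x"
      by (intro Max_in) auto
    then obtain a where "a \<in> actions x" "model.bellman x y a = Max (model.bellman x y ` actions x)"
      by auto
    then have "a \<in> ?A" using fin by auto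
    then have "Max ?A \<in> ?A" using fin by (intro Max_in) auto
    moreover have "?f x y = Max ?A"
      using True by (simp add: f_star_def Let_def G)
    ultimately show ?thesis by simp
  qed (simp add: actions_def f_star_def)
  have "model.policy_value \<pi>\<^sub>s x 0 = model.optimal_value x 0" for x
    unfolding \<pi>\<^sub>s_def using f by (intro model.generated_policy_attains_optimal_value) auto
  moreover have "\<pi>\<^sub>s \<in> policies"
    unfolding \<pi>\<^sub>s_def using f by (intro generated_policy_in_policies) auto
  ultimately show ?thesis
    by (simp add: J_hat_def J_hat_policy model.optimal_value_def)
qed

end
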